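(* In the downlink NOMA model of the context with $K$ subcarriers (CD-NOMA), assume $a_m>\varepsilon_m a_n$. Consider the connection outage probability of the $n$-th user for the existing formulation (EXF), $P_{n1}(\rho)=\Pr\{\gamma_{n\to m}\le\varepsilon_m\}+\Pr\{\gamma_{n\to m}>\varepsilon_m,\ \gamma_n\le\varepsilon_n\}$. Its diversity order is $0$ with imperfect SIC ($\varpi=1$) and $nK$ with perfect SIC ($\varpi=0$).
   Context: Fix integers $M>K\ge 1$ and $1\le m<n\le M$, reals $\eta,\alpha,R_D,\Omega_I>0$, power coefficients $a_m>a_n>0$ with $a_m+a_n=1$, and target rates $R_m,R_n>0$ with $\varepsilon_m=2^{R_m}-1$, $\varepsilon_n=2^{R_n}-1$; $\rho>0$ is the transmit SNR. ($K\neq1$ is called CD-NOMA, $K=1$ PD-NOMA.) $M$ users are placed independently and uniformly in a disc of radius $R_D$ centred at the base station. A user at distance $d$ from the centre has channel vector in $\mathbb{C}^K$ with entries $\sqrt{\eta}\,h_k/\sqrt{1+d^\alpha}$, $k=1,\dots,K$, where the $h_k$ are i.i.d. $\mathcal{CN}(0,1)$ (circularly symmetric, $\mathbb{E}|h_k|^2=1$), independent across users and of the locations. Users are relabelled so that their channel vectors satisfy $\|\mathbf h_1\|_2^2<\dots<\|\mathbf h_M\|_2^2$. The signals of users $m$ and $n$ are spread over the $K$ subcarriers by indicator vectors $\mathbf g_m,\mathbf g_n\in\{0,1\}^K$ of the same weight, all $K$ subcarriers being occupied, so $\|\mathrm{diag}(\mathbf h_n)\mathbf g_m\|_2^2=\|\mathrm{diag}(\mathbf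 h_n)\mathbf g_n\|_2^2=\|\mathbf h_n\|_2^2=:Z_n$. The residual interference vector $\mathbf h_I$ has $K$ i.i.d. $\mathcal{CN}(0,\Omega_I)$ entries, independent of everything else, and $Y_I=\|\mathbf h_I\|_2^2$. SINRs: $\gamma_{n\to m}=\frac{\rho Z_n a_m}{\rho Z_n a_n+1}$ and $\gamma_n=\frac{\rho Z_n a_n}{\varpi\rho Y_I+1}$. Diversity order of an outage probability $P(\rho)$: $d=-\lim_{\rho\to\infty}\frac{\log P^\infty(\rho)}{\log\rho}$, where $P^\infty$ is the asymptotic outage probability at high SNR, i.e. $P(\rho)/P^\infty(\rho)\to1$ as $\rho\to\infty$. *)

theory Defs
  imports "HOL-Probability.Probability"
begin

text \<open>Density, with respect to Lebesgue measure on the complex plane, of the circularly symmetric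
  complex normal distribution with mean 0 and \<open>E |X|\<^sup>2 = v\<close>.\<close>

definition complex_normal_density :: "real \<Rightarrow> complex \<Rightarrow> real" where
  "complex_normal_density v z = exp (- (cmod z)\<^sup>2 / v) / (pi * v)"

text \<open>Index set of the primitive random variables. All of them are complex valued (the plane
  containing the disc is identified with the complex numbers, the base station being at 0), so that
  joint independence can be stated for a single family.\<close>

datatype source = Location nat | Fading nat nat | Interference nat

locale noma_randomness = prob_space \<Omega> for \<Omega> :: "'w measure" +
  fixes M K :: nat and R\<^sub>D \<Omega>\<^sub>I :: real
    and loc :: "nat \<Rightarrow> 'w \<Rightarrow> complex"
    and h :: "nat \<Rightarrow> nat \<Rightarrow> 'w \<Rightarrow> complex"
    and h\<^sub>I :: "nat \<Rightarrow> 'w \<Rightarrow> complex"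
  assumes location_uniform:
      "\<And>i. i \<in> {1..M} \<Longrightarrow> distr \<Omega> borel (loc i) = uniform_measure lborel (cball 0 R\<^sub>D)"
    and fading_normal:
      "\<And>i k. i \<in> {1..M} \<Longrightarrow> k \<in> {1..K} \<Longrightarrow>
         distributed \<Omega> lborel (h i k) (complex_normal_density 1)"
    and interference_normal:
      "\<And>k. k \<in> {1..K} \<Longrightarrow>
         distributed \<Omega> lborel (h\<^sub>I k) (complex_normal_density \<Omega>\<^sub>I)"
    and independent:
      "indep_vars (\<lambda>_. borel)
         (\<lambda>s. case s of Location i \<Rightarrow> loc i | Fading i k \<Rightarrow> h i k | Interference k \<Rightarrow> h\<^sub>I k)
         (Location ` {1..M} \<union> (\<lambda>(i, k). Fading i k) ` ({1..M} \<times> {1..K}) \<union> Interference ` {1..K})"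

text \<open>Vectors in \<open>\<complex>\<^sup>K\<close> are functions on the naturals, of which only the entries with index in
  \<open>{1..K}\<close> matter.\<close>

definition sq_norm :: "nat \<Rightarrow> (nat \<Rightarrow> complex) \<Rightarrow> real" where
  "sq_norm K v = (L2_set (\<lambda>k. cmod (v k)) {1..K})\<^sup>2"

definition user_channel ::
  "real \<Rightarrow> real \<Rightarrow> (nat \<Rightarrow> 'w \<Rightarrow> complex) \<Rightarrow> (nat \<Rightarrow> nat \<Rightarrow> 'w \<Rightarrow> complex) \<Rightarrow> nat \<Rightarrow> 'w \<Rightarrow> nat \<Rightarrow> complex"
where
  "user_channel \<eta> \<alpha> loc h i \<omega> k =
     of_real (sqrt \<eta>) * h i k \<omega> / of_real (sqrt (1 + cmod (loc i \<omega>) powr \<alpha>))"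

text \<open>Original label of the user that receives the new label \<open>n\<close> (counted from 1) when the users
  \<open>1, \<dots>, M\<close> are relabelled by increasing gain \<open>G\<close>. Ties, which have probability 0 for the channel
  gains, are broken by the original label.\<close>

definition ranked_user :: "nat \<Rightarrow> (nat \<Rightarrow> real) \<Rightarrow> nat \<Rightarrow> nat" where
  "ranked_user M G n = sort_key G [1..<Suc M] ! (n - 1)"

definition ordered_channel ::
  "nat \<Rightarrow> nat \<Rightarrow> real \<Rightarrow> real \<Rightarrow> (nat \<Rightarrow> 'w \<Rightarrow> complex) \<Rightarrow> (nat \<Rightarrow> nat \<Rightarrow> 'w \<Rightarrow> complex) \<Rightarrow>
   nat \<Rightarrow> 'w \<Rightarrow> nat \<Rightarrow> complex"
where
  "ordered_channel M K \<eta> \<alpha> loc h n \<omega> =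
     user_channel \<eta> \<alpha> loc h (ranked_user M (\<lambda>i. sq_norm K (user_channel \<eta> \<alpha> loc h i \<omega>)) n) \<omega>"

definition sinr_cross :: "real \<Rightarrow> real \<Rightarrow> real \<Rightarrow> real \<Rightarrow> real" where
  "sinr_cross a\<^sub>m a\<^sub>n \<rho> z = \<rho> * z * a\<^sub>m / (\<rho> * z * a\<^sub>n + 1)"

definition sinr_own :: "real \<Rightarrow> real \<Rightarrow> real \<Rightarrow> real \<Rightarrow> real \<Rightarrow> real" where
  "sinr_own \<kappa> a\<^sub>n \<rho> z y = \<rho> * z * a\<^sub>n / (\<kappa> * \<rho> * y + 1)"

text \<open>Connection outage probability of the stronger user for the existing formulation, given its
  channel gain \<open>Z\<close>, the residual interference \<open>Y\<close> and the SIC indicator \<open>\<kappa>\<close> (1: imperfect SIC,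
  0: perfect SIC), as a function of the transmit SNR \<open>\<rho>\<close>.\<close>

definition outage_EXF ::
  "'w measure \<Rightarrow> ('w \<Rightarrow> real) \<Rightarrow> ('w \<Rightarrow> real) \<Rightarrow> real \<Rightarrow> real \<Rightarrow> real \<Rightarrow> real \<Rightarrow> real \<Rightarrow> real \<Rightarrow> real"
where
  "outage_EXF \<Omega> Z Y a\<^sub>m a\<^sub>n \<epsilon>\<^sub>m \<epsilon>\<^sub>n \<kappa> \<rho> =
     measure \<Omega> {\<omega> \<in> space \<Omega>. sinr_cross a\<^sub>m a\<^sub>n \<rho> (Z \<omega>) \<le> \<epsilon>\<^sub>m} +
     measure \<Omega> {\<omega> \<in> space \<Omega>. sinr_cross a\<^sub>m a\<^sub>n \<rho> (Z \<omega>) > \<epsilon>\<^sub>m \<and>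
                              sinr_own \<kappa> a\<^sub>n \<rho> (Z \<omega>) (Y \<omega>) \<le> \<epsilon>\<^sub>n}"

definition high_snr_asymptote :: "(real \<Rightarrow> real) \<Rightarrow> (real \<Rightarrow> real) \<Rightarrow> bool" where
  "high_snr_asymptote P Q \<longleftrightarrow> ((\<lambda>\<rho>. P \<rho> / Q \<rho>) \<longlongrightarrow> 1) at_top"

text \<open>The asymptotic outage probability is determined only up to asymptotic equivalence, so one is
  required to exist and every one to give the same value.\<close>

definition has_diversity_order :: "(real \<Rightarrow> real) \<Rightarrow> real \<Rightarrow> bool" where
  "has_diversity_order P d \<longleftrightarrow>
     (\<exists>Q. high_snr_asymptote P Q) \<and>
     (\<forall>Q. high_snr_asymptote P Q \<longrightarrow> ((\<lambda>\<rho>. ln (Q \<rho>) / ln \<rho>) \<longlongrightarrow> - d) at_top)"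

end

theory Submission imports Defs "HOL-Real_Asymp.Real_Asymp" begin

text \<open>Only the order of magnitude of the outage probability matters, so no exact asymptotics and no
  gain density are needed. The event \<open>Z\<^sub>n \<le> x\<close> says that at least \<open>n\<close> users have gain at most \<open>x\<close>.
  As the path loss is bounded on the disc, it lies between two events of the form ``\<open>n\<close> users have
  all \<open>|h\<^sub>k|\<^sup>2\<close> at most a multiple of \<open>x\<close>'', and each \<open>|h\<^sub>k|\<^sup>2 \<le> r\<close> has probability of order \<open>r\<close>;
  hence \<open>Pr (Z\<^sub>n \<le> x)\<close> is of order \<open>x\<^sup>n\<^sup>K\<close> for small \<open>x\<close>. With perfect SIC the outage is squeezed
  between such probabilities with \<open>x\<close> proportional to \<open>1 / \<rho>\<close>. With imperfect SIC it always contains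
  the event \<open>a\<^sub>n Z\<^sub>n \<le> \<epsilon>\<^sub>n Y\<^sub>I\<close>, whose probability is positive and does not depend on \<open>\<rho>\<close>.\<close>

section \<open>Ranks and counting\<close>

text \<open>In a sorted list the entries at most \<open>x\<close> form an initial segment. Each
  direction compares the cardinality of the set of their indices with that of an initial segment of
  the naturals.\<close>

lemma sorted_nth_le_iff:
  fixes ys :: "'a::linorder list"
  assumes "sorted ys" and "j < length ys"
  shows "ys ! j \<le> x \<longleftrightarrow> j < length (filter (\<lambda>y. y \<le> x) ys)"
proof
  assume "ys ! j \<le> x"
  then have "{..j} \<subseteq> {i. i < length ys \<and> ys ! i \<le> x}"
    using assms by (auto dest: sorted_nth_mono intro: order_trans)
  then have "card {..j} \<le> card {i. i < length ys \<and> ys ! i \<le> x}"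
    by (intro card_mono) auto
  then show "j < length (filter (\<lambda>y. y \<le> x) ys)"
    by (simp add: length_filter_conv_card)
next
  assume less: "j < length (filter (\<lambda>y. y \<le> x) ys)"
  show "ys ! j \<le> x"
  proof (rule ccontr)
    assume "\<not> ys ! j \<le> x"
    then have "{i. i < length ys \<and> ys ! i \<le> x} \<subseteq> {..<j}"
      using assms sorted_nth_mono[of ys j] by (force simp: not_le)
    then have "card {i. i < length ys \<and> ys ! i \<le> x} \<le> card {..<j}"
      by (intro card_mono) auto
    then show False
      using less by (simp add: length_filter_conv_card)
  qed
qed

text \<open>Sorting by \<open>G\<close> permutes the distinct labels \<open>1..M\<close>, so
  counting list entries is counting users. Ranks start at 1 and list positions at 0, hence
  \<open>n - 1 < l\<close> turns into \<open>n \<le> l\<close>.\<close>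

lemma ranked_user_gain_le_iff:
  assumes "1 \<le> n" and "n \<le> M"
  shows "G (ranked_user M G n) \<le> x \<longleftrightarrow> n \<le> card {i \<in> {1..M}. G i \<le> x}"
proof -
  let ?xs = "sort_key G [1..<Suc M]"
  have len: "n - 1 < length ?xs"
    using assms by simp
  have "G (ranked_user M G n) = map G ?xs ! (n - 1)"
    using len by (simp add: ranked_user_def)
  also have "\<dots> \<le> x \<longleftrightarrow> n - 1 < length (filter (\<lambda>y. y \<le> x) (map G ?xs))"
    using len by (intro sorted_nth_le_iff) auto
  also have "length (filter (\<lambda>y. y \<le> x) (map G ?xs)) = length (filter (\<lambda>i. G i \<le> x) ?xs)"
    by (simp add: filter_map o_def)
  also have "\<dots> = card (set (filter (\<lambda>i. G i \<le> x) ?xs))"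
    by (rule distinct_card[symmetric]) simp
  also have "set (filter (\<lambda>i. G i \<le> x) ?xs) = {i \<in> {1..M}. G i \<le> x}"
    by auto
  finally show ?thesis
    using assms by auto
qed

text \<open>This removes the random relabelling: the event becomes a finite union, over
  deterministic sets \<open>S\<close> of original labels, of events to which independence and the
  union bound apply.\<close>

lemma ranked_user_gain_le_iff_subset:
  assumes "1 \<le> n" and "n \<le> M"
  shows "G (ranked_user M G n) \<le> x \<longleftrightarrow> (\<exists>S. S \<subseteq> {1..M} \<and> card S = n \<and> (\<forall>i\<in>S. G i \<le> x))"
proof -
  have "n \<le> card {i \<in> {1..M}. G i \<le> x} \<longleftrightarrow> (\<exists>S\<subseteq>{i \<in> {1..M}. G i \<le> x}. card S = n)"
    by (auto dest: obtain_subset_with_card_n intro: card_mono)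
  also have "\<dots> \<longleftrightarrow> (\<exists>S. S \<subseteq> {1..M} \<and> card S = n \<and> (\<forall>i\<in>S. G i \<le> x))"
    by blast
  finally show ?thesis
    using ranked_user_gain_le_iff[OF assms, of G x] by simp
qed

section \<open>Gains of individual users\<close>

lemma sq_norm_eq_sum: "sq_norm K v = (\<Sum>k\<in>{1..K}. (cmod (v k))\<^sup>2)"
  by (simp add: sq_norm_def L2_set_def sum_nonneg)

lemma sq_norm_nonneg: "0 \<le> sq_norm K v"
  by (simp add: sq_norm_def)

lemma sq_norm_user_channel:
  assumes "\<eta> > 0"
  shows "sq_norm K (user_channel \<eta> \<alpha> loc h i \<omega>) =
    \<eta> * (\<Sum>k\<in>{1..K}. (cmod (h i k \<omega>))\<^sup>2) / (1 + cmod (loc i \<omega>) powr \<alpha>)"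
proof -
  have "0 \<le> 1 + cmod (loc i \<omega>) powr \<alpha>"
    by (simp add: add_nonneg_nonneg)
  then show ?thesis
    using assms unfolding sq_norm_eq_sum user_channel_def
    by (simp add: norm_mult norm_divide power_mult_distrib power_divide
        sum_distrib_left sum_divide_distrib)
qed

lemma sq_norm_ordered_channel:
  "sq_norm K (ordered_channel M K \<eta> \<alpha> loc h n \<omega>) =
    sq_norm K (user_channel \<eta> \<alpha> loc h
      (ranked_user M (\<lambda>i. sq_norm K (user_channel \<eta> \<alpha> loc h i \<omega>)) n) \<omega>)"
  by (simp add: ordered_channel_def)

section \<open>The complex normal law near the origin\<close>

lemma emeasure_lborel_complex_cball:
  "r \<ge> 0 \<Longrightarrow> emeasure lborel (cball (c::complex) r) = ennreal (pi * r\<^sup>2)"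
  by (simp add: emeasure_cball unit_ball_vol_2)

lemma sq_le_eq_cball:
  assumes "r \<ge> 0"
  shows "{z::complex. (cmod z)\<^sup>2 \<le> r} = cball 0 (sqrt r)"
proof -
  have "(cmod z)\<^sup>2 \<le> r \<longleftrightarrow> cmod z \<le> sqrt r" for z :: complex
    using real_sqrt_le_iff[of "(cmod z)\<^sup>2" r] by simp
  then show ?thesis
    by (simp only: set_eq_iff mem_Collect_eq mem_cball_0) simp
qed

context prob_space
begin

text \<open>The event is a disc of area \<open>pi * r\<close>, on which the density lies between
  \<open>exp (- r / v) / (pi * v)\<close> and \<open>1 / (pi * v)\<close>. Integrating these two
  constants over the disc gives the bounds.\<close>

lemma complex_normal_sq_le:
  assumes X: "distributed M lborel X (complex_normal_density v)" and "v > 0" and "r \<ge> 0"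
  shows complex_normal_sq_le_upper: "prob (X -` {z. (cmod z)\<^sup>2 \<le> r} \<inter> space M) \<le> r / v"
    and complex_normal_sq_le_lower:
      "exp (- r / v) * (r / v) \<le> prob (X -` {z. (cmod z)\<^sup>2 \<le> r} \<inter> space M)"
proof -
  let ?A = "{z::complex. (cmod z)\<^sup>2 \<le> r}"
  have A: "?A \<in> sets lborel" by simp
  have vol: "emeasure lborel ?A = ennreal (pi * r)"
    using \<open>r \<ge> 0\<close> by (simp add: sq_le_eq_cball emeasure_lborel_complex_cball)
  have prob_eq: "emeasure M (X -` ?A \<inter> space M) =
      (\<integral>\<^sup>+z. ennreal (complex_normal_density v z) * indicator ?A z \<partial>lborel)"
    using X A by (rule distributed_emeasure)
  have "emeasure M (X -` ?A \<inter> space M) \<le> (\<integral>\<^sup>+z. ennreal (1 / (pi * v)) * indicator ?A z \<partial>lborel)"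
    unfolding prob_eq using \<open>v > 0\<close>
    by (intro nn_integral_mono mult_right_mono ennreal_leI)
       (auto simp: complex_normal_density_def divide_simps)
  also have "\<dots> = ennreal (r / v)"
    using \<open>v > 0\<close> \<open>r \<ge> 0\<close> vol by (simp add: nn_integral_cmult_indicator flip: ennreal_mult)
  finally show "prob (X -` ?A \<inter> space M) \<le> r / v"
    using \<open>v > 0\<close> \<open>r \<ge> 0\<close> by (simp add: emeasure_eq_measure)
  have "ennreal (exp (- r / v) * (r / v)) =
      (\<integral>\<^sup>+z. ennreal (exp (- r / v) / (pi * v)) * indicator ?A z \<partial>lborel)"
    using \<open>v > 0\<close> \<open>r \<ge> 0\<close> vol by (simp add: nn_integral_cmult_indicator flip: ennreal_mult)
  also have "\<dots> \<le> emeasure M (X -` ?A \<inter> space M)"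
    unfolding prob_eq using \<open>v > 0\<close>
    by (intro nn_integral_mono)
       (auto simp: complex_normal_density_def divide_simps indicator_def intro!: ennreal_leI)
  finally show "exp (- r / v) * (r / v) \<le> prob (X -` ?A \<inter> space M)"
    by (simp add: emeasure_eq_measure)
qed

end

section \<open>Joint fading and interference events\<close>

context noma_randomness
begin

abbreviation fading_sources :: "nat set \<Rightarrow> source set" where
  "fading_sources S \<equiv> (\<lambda>(i, k). Fading i k) ` (S \<times> {1..K})"

lemma card_fading_sources: "card (fading_sources S) = card S * K"
  by (subst card_image) (auto simp: inj_on_def card_cartesian_product)

lemma loc_measurable: "i \<in> {1..M} \<Longrightarrow> loc i \<in> borel_measurable \<Omega>"
  using independent unfolding indep_vars_def by (force split: source.splits)

lemma fading_measurable: "i \<in> {1..M} \<Longrightarrow> k \<in> {1..K} \<Longrightarrow> h i k \<in> borel_measurable \<Omega>"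
  using fading_normal[of i k] by (simp add: distributed_def)

lemma interference_measurable: "k \<in> {1..K} \<Longrightarrow> h\<^sub>I k \<in> borel_measurable \<Omega>"
  using interference_normal[of k] by (simp add: distributed_def)

text \<open>Only the law of \<open>loc i\<close> is prescribed, so the location lies in the disc
  almost surely rather than everywhere. This is what later bounds the path loss.\<close>

lemma AE_location_bounded:
  assumes "i \<in> {1..M}"
  shows "AE \<omega> in \<Omega>. cmod (loc i \<omega>) \<le> R\<^sub>D"
proof -
  have "AE z in uniform_measure lborel (cball (0::complex) R\<^sub>D). z \<in> cball 0 R\<^sub>D"
    by (rule AE_uniform_measureI) auto
  then have "AE z in distr \<Omega> borel (loc i). z \<in> cball 0 R\<^sub>D"
    by (simp only: location_uniform[OF assms])
  then show ?thesis
    using loc_measurable[OF assms] by (subst (asm) AE_distr_iff) auto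
qed

text \<open>Independence factors the joint event into \<open>card S * K\<close> events, each
  controlled by the bounds for a single complex normal variable with \<open>v = 1\<close>.\<close>

lemma prob_fading_le:
  assumes "S \<subseteq> {1..M}" and "S \<noteq> {}" and "1 \<le> K" and "0 \<le> r"
  shows prob_fading_le_upper:
      "prob {\<omega> \<in> space \<Omega>. \<forall>i\<in>S. \<forall>k\<in>{1..K}. (cmod (h i k \<omega>))\<^sup>2 \<le> r} \<le> r ^ (card S * K)"
    and prob_fading_le_lower:
      "(exp (- r) * r) ^ (card S * K) \<le>
        prob {\<omega> \<in> space \<Omega>. \<forall>i\<in>S. \<forall>k\<in>{1..K}. (cmod (h i k \<omega>))\<^sup>2 \<le> r}"
proof -
  define V where "V = (\<lambda>s. case s of Location i \<Rightarrow> loc i | Fading i k \<Rightarrow> h i k | Interference k \<Rightarrow> h\<^sub>I k)"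
  let ?A = "{z::complex. (cmod z)\<^sup>2 \<le> r}"
  let ?J = "fading_sources S"
  have "prob (\<Inter>s\<in>?J. V s -` ?A \<inter> space \<Omega>) = (\<Prod>s\<in>?J. prob (V s -` ?A \<inter> space \<Omega>))"
    unfolding V_def using assms finite_subset[OF assms(1)]
    by (intro indep_varsD[OF independent]) auto
  \<comment> \<open>An intersection over the empty index set would be the whole type instead of
    \<open>space \<Omega>\<close>.\<close>
  moreover have "?J \<noteq> {}"
    using assms(2,3) by auto
  then have "(\<Inter>s\<in>?J. V s -` ?A \<inter> space \<Omega>) = {\<omega> \<in> space \<Omega>. \<forall>s\<in>?J. V s \<omega> \<in> ?A}"
    by blast
  moreover have "(\<forall>s\<in>?J. V s \<omega> \<in> ?A) \<longleftrightarrow> (\<forall>i\<in>S. \<forall>k\<in>{1..K}. (cmod (h i k \<omega>))\<^sup>2 \<le> r)" for \<omega>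
    by (simp add: V_def split_beta)
  ultimately have eq: "prob {\<omega> \<in> space \<Omega>. \<forall>i\<in>S. \<forall>k\<in>{1..K}. (cmod (h i k \<omega>))\<^sup>2 \<le> r} =
      (\<Prod>s\<in>?J. prob (V s -` ?A \<inter> space \<Omega>))"
    by simp
  have bounds: "prob (V s -` ?A \<inter> space \<Omega>) \<le> r \<and> exp (- r) * r \<le> prob (V s -` ?A \<inter> space \<Omega>)"
    if s_in: "s \<in> ?J" for s
  proof -
    obtain i k where s: "s = Fading i k" and "i \<in> {1..M}" and "k \<in> {1..K}"
      using s_in assms(1) by auto
    then have "distributed \<Omega> lborel (h i k) (complex_normal_density 1)"
      by (intro fading_normal)
    from complex_normal_sq_le[OF this zero_less_one assms(4)] show ?thesis
      by (simp add: s V_def)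
  qed
  have "(\<Prod>s\<in>?J. prob (V s -` ?A \<inter> space \<Omega>)) \<le> (\<Prod>s\<in>?J. r)"
    using bounds by (intro prod_mono) auto
  then show "prob {\<omega> \<in> space \<Omega>. \<forall>i\<in>S. \<forall>k\<in>{1..K}. (cmod (h i k \<omega>))\<^sup>2 \<le> r} \<le> r ^ (card S * K)"
    unfolding eq by (simp only: prod_constant card_fading_sources)
  have "(\<Prod>s\<in>?J. exp (- r) * r) \<le> (\<Prod>s\<in>?J. prob (V s -` ?A \<inter> space \<Omega>))"
    using bounds assms(4) by (intro prod_mono) auto
  then show "(exp (- r) * r) ^ (card S * K) \<le>
      prob {\<omega> \<in> space \<Omega>. \<forall>i\<in>S. \<forall>k\<in>{1..K}. (cmod (h i k \<omega>))\<^sup>2 \<le> r}"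
    unfolding eq by (simp only: prod_constant card_fading_sources)
qed

text \<open>Provides an event of weak fading and strong interference for the imperfect SIC case. By
  independence its probability is a finite product of positive factors; one interference coefficient
  suffices, as it bounds the total interference from below.\<close>

lemma prob_fading_le_interference_gt_pos:
  assumes "S \<subseteq> {1..M}" and "1 \<le> K" and "0 < r" and "0 < \<Omega>\<^sub>I"
  shows "0 < prob {\<omega> \<in> space \<Omega>. (\<forall>i\<in>S. \<forall>k\<in>{1..K}. (cmod (h i k \<omega>))\<^sup>2 \<le> r) \<and>
    (cmod (h\<^sub>I 1 \<omega>))\<^sup>2 > \<Omega>\<^sub>I / 2}"
proof -
  define V where "V = (\<lambda>s. case s of Location i \<Rightarrow> loc i | Fading i k \<Rightarrow> h i k | Interference k \<Rightarrow> h\<^sub>I k)"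
  define A where "A = (\<lambda>s. case s of Interference k \<Rightarrow> {z::complex. (cmod z)\<^sup>2 > \<Omega>\<^sub>I / 2}
    | _ \<Rightarrow> {z::complex. (cmod z)\<^sup>2 \<le> r})"
  let ?J = "insert (Interference 1) (fading_sources S)"
  have sets_A: "A s \<in> sets borel" for s
    by (simp add: A_def split: source.split)
  have "prob (\<Inter>s\<in>?J. V s -` A s \<inter> space \<Omega>) = (\<Prod>s\<in>?J. prob (V s -` A s \<inter> space \<Omega>))"
    unfolding V_def using assms finite_subset[OF assms(1)] sets_A
    by (intro indep_varsD[OF independent]) auto
  moreover have "(\<Inter>s\<in>?J. V s -` A s \<inter> space \<Omega>) = {\<omega> \<in> space \<Omega>. \<forall>s\<in>?J. V s \<omega> \<in> A s}"
    by blast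
  moreover have "(\<forall>s\<in>?J. V s \<omega> \<in> A s) \<longleftrightarrow>
      (\<forall>i\<in>S. \<forall>k\<in>{1..K}. (cmod (h i k \<omega>))\<^sup>2 \<le> r) \<and> (cmod (h\<^sub>I 1 \<omega>))\<^sup>2 > \<Omega>\<^sub>I / 2" for \<omega>
    by (auto simp: V_def A_def)
  moreover have "0 < (\<Prod>s\<in>?J. prob (V s -` A s \<inter> space \<Omega>))"
  proof (rule prod_pos)
    fix s assume "s \<in> ?J"
    then consider "s = Interference 1"
      | i k where "s = Fading i k" and "i \<in> {1..M}" and "k \<in> {1..K}"
      using assms(1) by auto
    then show "0 < prob (V s -` A s \<inter> space \<Omega>)"
    proof cases
      case 1
      let ?B = "h\<^sub>I 1 -` {z. (cmod z)\<^sup>2 \<le> \<Omega>\<^sub>I / 2} \<inter> space \<Omega>"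
      have "h\<^sub>I 1 \<in> borel_measurable \<Omega>"
        using assms(2) by (intro interference_measurable) auto
      then have "?B \<in> events"
        by (rule measurable_sets) simp
      \<comment> \<open>The level \<open>\<Omega>\<^sub>I / 2\<close> makes this upper bound equal
        to 1/2, so the complement keeps probability at least 1/2.\<close>
      moreover have "prob ?B \<le> \<Omega>\<^sub>I / 2 / \<Omega>\<^sub>I"
        using assms by (intro complex_normal_sq_le_upper interference_normal) auto
      moreover have "V s -` A s \<inter> space \<Omega> = space \<Omega> - ?B"
        by (auto simp: 1 V_def A_def)
      ultimately show ?thesis
        using assms(4) by (simp add: prob_compl)
    next
      case 2
      have "0 < exp (- r / 1) * (r / 1)"
        using assms(3) by simp
      also have "\<dots> \<le> prob (h i k -` {z. (cmod z)\<^sup>2 \<le> r} \<inter> space \<Omega>)"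
        using 2 assms(3) by (intro complex_normal_sq_le_lower fading_normal) auto
      finally show ?thesis
        by (simp add: 2 V_def A_def)
    qed
  qed
  ultimately show ?thesis
    by simp
qed

section \<open>Distribution of the ordered gain near 0\<close>

context
  fixes \<eta> \<alpha> :: real and n :: nat and Z :: "'w \<Rightarrow> real"
  assumes K_pos: "1 \<le> K" and eta_pos: "\<eta> > 0" and n_pos: "1 \<le> n" and n_le: "n \<le> M"
  defines "Z \<equiv> (\<lambda>\<omega>. sq_norm K (ordered_channel M K \<eta> \<alpha> loc h n \<omega>))"
begin

lemma ordered_gain_le_iff:
  "Z \<omega> \<le> x \<longleftrightarrow>
    (\<exists>S. S \<subseteq> {1..M} \<and> card S = n \<and> (\<forall>i\<in>S. sq_norm K (user_channel \<eta> \<alpha> loc h i \<omega>) \<le> x))"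
  unfolding Z_def sq_norm_ordered_channel
  by (rule ranked_user_gain_le_iff_subset[OF n_pos n_le])

lemma user_gain_measurable:
  assumes "i \<in> {1..M}"
  shows "(\<lambda>\<omega>. sq_norm K (user_channel \<eta> \<alpha> loc h i \<omega>)) \<in> borel_measurable \<Omega>"
proof -
  have [measurable]: "loc i \<in> borel_measurable \<Omega>"
    using assms by (rule loc_measurable)
  have [measurable]: "\<And>k. k \<in> {1..K} \<Longrightarrow> h i k \<in> borel_measurable \<Omega>"
    using assms by (rule fading_measurable)
  show ?thesis
    unfolding sq_norm_user_channel[OF eta_pos] by measurable
qed

text \<open>The user of rank \<open>n\<close> varies with \<open>\<omega>\<close>, so measurability
  is checked on sublevel sets: each is a finite union over \<open>S\<close> of finite intersections
  of sublevel sets of individual gains.\<close>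

lemma ordered_gain_measurable: "Z \<in> borel_measurable \<Omega>"
proof (rule borel_measurableI_le)
  fix x
  have "{\<omega> \<in> space \<Omega>. Z \<omega> \<le> x} =
      (\<Union>S\<in>{S. S \<subseteq> {1..M} \<and> card S = n}.
        {\<omega> \<in> space \<Omega>. \<forall>i\<in>S. sq_norm K (user_channel \<eta> \<alpha> loc h i \<omega>) \<le> x})"
    unfolding ordered_gain_le_iff by auto
  also have "\<dots> \<in> events"
  proof (rule sets.finite_UN)
    fix S assume "S \<in> {S. S \<subseteq> {1..M} \<and> card S = n}"
    then have S: "S \<subseteq> {1..M}" "finite S"
      by (auto intro: finite_subset)
    have [measurable]: "(\<lambda>\<omega>. sq_norm K (user_channel \<eta> \<alpha> loc h i \<omega>)) \<in> borel_measurable \<Omega>"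
      if "i \<in> S" for i
      using S that by (intro user_gain_measurable) auto
    show "{\<omega> \<in> space \<Omega>. \<forall>i\<in>S. sq_norm K (user_channel \<eta> \<alpha> loc h i \<omega>) \<le> x} \<in> events"
      using S by measurable
  qed simp
  finally show "{\<omega> \<in> space \<Omega>. Z \<omega> \<le> x} \<in> events" .
qed

text \<open>The users \<open>{1..n}\<close> serve as the set \<open>S\<close>. The path-loss
  denominator is at least 1 and can only lower a gain, and the budget \<open>x / \<eta>\<close> is
  shared equally among the \<open>K\<close> subcarriers.\<close>

lemma ordered_gain_le_of_fading_le:
  assumes "\<forall>i\<in>{1..n}. \<forall>k\<in>{1..K}. (cmod (h i k \<omega>))\<^sup>2 \<le> x / (\<eta> * real K)"
  shows "Z \<omega> \<le> x"
proof -
  have "sq_norm K (user_channel \<eta> \<alpha> loc h i \<omega>) \<le> x" if "i \<in> {1..n}" for i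
  proof -
    let ?s = "\<Sum>k\<in>{1..K}. (cmod (h i k \<omega>))\<^sup>2"
    have "?s \<le> real (card {1..K}) * (x / (\<eta> * real K))"
      using assms that by (intro sum_bounded_above) auto
    then have "\<eta> * ?s \<le> x"
      using eta_pos K_pos by (simp add: field_simps)
    moreover have "\<eta> * ?s / (1 + cmod (loc i \<omega>) powr \<alpha>) \<le> \<eta> * ?s / 1"
      using eta_pos by (intro divide_left_mono mult_nonneg_nonneg sum_nonneg) (auto simp: add_pos_nonneg)
    ultimately show ?thesis
      using sq_norm_user_channel[OF eta_pos, of K \<alpha> loc h i \<omega>] by simp
  qed
  then show ?thesis
    unfolding ordered_gain_le_iff using n_le by (intro exI[of _ "{1..n}"]) auto
qed

text \<open>Weak fading of the users \<open>{1..n}\<close> already forces the event. The restriction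
  on \<open>x\<close> gives \<open>r \<le> 1\<close>, so \<open>exp (- r)\<close> is at least
  \<open>exp (- 1)\<close> and the constant does not depend on \<open>x\<close>.\<close>

lemma prob_ordered_gain_le_lower:
  assumes "0 \<le> x" and "x \<le> \<eta> * real K"
  shows "(exp (- 1) / (\<eta> * real K)) ^ (n * K) * x ^ (n * K) \<le> prob {\<omega> \<in> space \<Omega>. Z \<omega> \<le> x}"
proof -
  define r where "r = x / (\<eta> * real K)"
  have r: "0 \<le> r" "r \<le> 1"
    using assms eta_pos K_pos by (auto simp: r_def divide_simps)
  have "(exp (- 1) / (\<eta> * real K)) ^ (n * K) * x ^ (n * K) = (exp (- 1) * r) ^ (n * K)"
    by (simp add: r_def power_mult_distrib power_divide)
  also have "\<dots> \<le> (exp (- r) * r) ^ (card {1..n} * K)"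
    using r by (auto intro!: power_mono mult_right_mono)
  also have "\<dots> \<le> prob {\<omega> \<in> space \<Omega>. \<forall>i\<in>{1..n}. \<forall>k\<in>{1..K}. (cmod (h i k \<omega>))\<^sup>2 \<le> r}"
    using n_pos n_le K_pos r by (intro prob_fading_le_lower) auto
  also have "\<dots> \<le> prob {\<omega> \<in> space \<Omega>. Z \<omega> \<le> x}"
    using ordered_gain_measurable ordered_gain_le_of_fading_le
    by (intro finite_measure_mono) (auto simp: r_def)
  finally show ?thesis .
qed

text \<open>A union bound over all \<open>n\<close>-element sets of users: within the disc, a small
  gain forces each squared fading coefficient of that user to be small.\<close>

lemma prob_ordered_gain_le_upper:
  assumes "\<alpha> > 0"
  shows "\<exists>C. \<forall>x\<ge>0. prob {\<omega> \<in> space \<Omega>. Z \<omega> \<le> x} \<le> C * x ^ (n * K)"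
proof -
  \<comment> \<open>On the disc the path-loss denominator is at most
    \<open>1 + R\<^sub>D powr \<alpha>\<close>, so a gain at most \<open>x\<close> forces a total
    fading power at most \<open>c * x\<close>.\<close>
  define c where "c = (1 + R\<^sub>D powr \<alpha>) / \<eta>"
  have c: "0 \<le> c"
    using eta_pos by (simp add: c_def add_nonneg_nonneg)
  let ?SS = "{S. S \<subseteq> {1..M} \<and> card S = n}"
  let ?E = "\<lambda>r S. {\<omega> \<in> space \<Omega>. \<forall>i\<in>S. \<forall>k\<in>{1..K}. (cmod (h i k \<omega>))\<^sup>2 \<le> r}"
  have E_events: "?E r S \<in> events" if "S \<subseteq> {1..M}" for S r
  proof -
    have "finite S"
      using that by (rule finite_subset) simp
    have [measurable]: "h i k \<in> borel_measurable \<Omega>" if "i \<in> S" "k \<in> {1..K}" for i k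
      using that \<open>S \<subseteq> {1..M}\<close> by (intro fading_measurable) auto
    show ?thesis
      using \<open>finite S\<close> by measurable
  qed
  have "prob {\<omega> \<in> space \<Omega>. Z \<omega> \<le> x} \<le> (real (card ?SS) * c ^ (n * K)) * x ^ (n * K)" if "0 \<le> x" for x
  proof -
    have "AE \<omega> in \<Omega>. \<forall>i\<in>{1..M}. cmod (loc i \<omega>) \<le> R\<^sub>D"
      using AE_location_bounded by (intro AE_finite_allI) auto
    \<comment> \<open>The inclusion is only almost sure because the location bound is, so
      monotonicity of the measure is used in its AE form.\<close>
    then have "AE \<omega> in \<Omega>. \<omega> \<in> {\<omega> \<in> space \<Omega>. Z \<omega> \<le> x} \<longrightarrow> \<omega> \<in> (\<Union>S\<in>?SS. ?E (c * x) S)"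
    proof (rule AE_mp, intro AE_I2 impI)
      fix \<omega> assume loc: "\<forall>i\<in>{1..M}. cmod (loc i \<omega>) \<le> R\<^sub>D"
        and \<omega>: "\<omega> \<in> {\<omega> \<in> space \<Omega>. Z \<omega> \<le> x}"
      then obtain S where S: "S \<subseteq> {1..M}" "card S = n"
        and gain: "\<And>i. i \<in> S \<Longrightarrow> sq_norm K (user_channel \<eta> \<alpha> loc h i \<omega>) \<le> x"
        unfolding ordered_gain_le_iff by auto
      have "(cmod (h i k \<omega>))\<^sup>2 \<le> c * x" if "i \<in> S" "k \<in> {1..K}" for i k
      proof -
        let ?s = "\<Sum>k\<in>{1..K}. (cmod (h i k \<omega>))\<^sup>2"
        have pos: "0 < 1 + cmod (loc i \<omega>) powr \<alpha>"
          by (simp add: add_pos_nonneg)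
        have "\<eta> * ?s / (1 + cmod (loc i \<omega>) powr \<alpha>) \<le> x"
          using gain[OF \<open>i \<in> S\<close>] by (simp only: sq_norm_user_channel[OF eta_pos])
        then have "\<eta> * ?s \<le> x * (1 + cmod (loc i \<omega>) powr \<alpha>)"
          using pos by (simp add: pos_divide_le_eq)
        also have "\<dots> \<le> x * (1 + R\<^sub>D powr \<alpha>)"
          using S loc that assms \<open>0 \<le> x\<close> by (intro mult_left_mono add_left_mono powr_mono2) auto
        finally have "?s \<le> c * x"
          using eta_pos by (simp add: c_def field_simps)
        moreover have "(cmod (h i k \<omega>))\<^sup>2 \<le> ?s"
          using that by (intro member_le_sum) auto
        ultimately show ?thesis
          by simp
      qed
      then show "\<omega> \<in> (\<Union>S\<in>?SS. ?E (c * x) S)"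
        using S \<omega> by blast
    qed
    then have "prob {\<omega> \<in> space \<Omega>. Z \<omega> \<le> x} \<le> prob (\<Union>S\<in>?SS. ?E (c * x) S)"
      using E_events by (intro finite_measure_mono_AE sets.finite_UN) auto
    also have "\<dots> \<le> (\<Sum>S\<in>?SS. prob (?E (c * x) S))"
      using E_events by (intro finite_measure_subadditive_finite) auto
    also have "\<dots> \<le> (\<Sum>S\<in>?SS. (c * x) ^ (n * K))"
    proof (rule sum_mono)
      fix S assume "S \<in> ?SS"
      then have "S \<subseteq> {1..M}" "S \<noteq> {}" "card S = n"
        using n_pos by auto
      then show "prob (?E (c * x) S) \<le> (c * x) ^ (n * K)"
        using prob_fading_le_upper[of S "c * x"] K_pos c \<open>0 \<le> x\<close> by simp
    qed
    finally show ?thesis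
      by (simp add: power_mult_distrib)
  qed
  then show ?thesis
    by blast
qed

end

end

section \<open>Diversity order from two-sided power bounds\<close>

text \<open>After division by \<open>ln \<rho>\<close> the constants \<open>c\<close> and
  \<open>C\<close> vanish in the limit, so bounds of the same order fix the exponent. Passing from
  \<open>P\<close> to another asymptote \<open>Q\<close> changes the logarithm by
  \<open>ln (P \<rho> / Q \<rho>)\<close>, which tends to 0.\<close>

lemma has_diversity_orderI:
  fixes P :: "real \<Rightarrow> real"
  assumes "0 < c" and lower: "eventually (\<lambda>\<rho>. c * \<rho> powr - d \<le> P \<rho>) at_top"
    and upper: "eventually (\<lambda>\<rho>. P \<rho> \<le> C * \<rho> powr - d) at_top"
  shows "has_diversity_order P d"
proof -
  have P_pos: "eventually (\<lambda>\<rho>. 0 < P \<rho>) at_top"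
    using lower eventually_gt_at_top[of 0]
  proof eventually_elim
    case (elim \<rho>)
    then have "0 < c * \<rho> powr - d"
      using \<open>0 < c\<close> by simp
    with elim show ?case
      by linarith
  qed
  \<comment> \<open>\<open>C\<close> gets its sign from being squeezed above the positive values of
    \<open>P\<close>; this makes \<open>ln C\<close> meaningful below.\<close>
  have "eventually (\<lambda>\<rho>. 0 < C * \<rho> powr - d) at_top"
    using P_pos upper by eventually_elim linarith
  then have "C > 0"
    by (metis (no_types, lifting) eventually_at_top_linorder order_refl powr_ge_zero zero_less_mult_iff not_le)
  have P_lim: "((\<lambda>\<rho>. ln (P \<rho>) / ln \<rho>) \<longlongrightarrow> - d) at_top"
  proof (rule tendsto_sandwich)
    show "((\<lambda>\<rho>::real. (ln c - d * ln \<rho>) / ln \<rho>) \<longlongrightarrow> - d) at_top"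
      by real_asymp
    show "((\<lambda>\<rho>::real. (ln C - d * ln \<rho>) / ln \<rho>) \<longlongrightarrow> - d) at_top"
      by real_asymp
    show "eventually (\<lambda>\<rho>. (ln c - d * ln \<rho>) / ln \<rho> \<le> ln (P \<rho>) / ln \<rho>) at_top"
      using lower eventually_gt_at_top[of 1]
    proof eventually_elim
      case (elim \<rho>)
      have "ln c - d * ln \<rho> = ln (c * \<rho> powr - d)"
        using \<open>0 < c\<close> elim by (simp add: ln_mult ln_powr)
      also have "\<dots> \<le> ln (P \<rho>)"
        using \<open>0 < c\<close> elim by (intro ln_mono) auto
      finally show ?case
        using elim by (intro divide_right_mono) auto
    qed
    show "eventually (\<lambda>\<rho>. ln (P \<rho>) / ln \<rho> \<le> (ln C - d * ln \<rho>) / ln \<rho>) at_top"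
      using upper P_pos eventually_gt_at_top[of 1]
    proof eventually_elim
      case (elim \<rho>)
      have "ln (P \<rho>) \<le> ln (C * \<rho> powr - d)"
        using elim by (intro ln_mono) auto
      also have "\<dots> = ln C - d * ln \<rho>"
        using \<open>0 < C\<close> elim by (simp add: ln_mult ln_powr)
      finally show ?case
        using elim by (intro divide_right_mono) auto
    qed
  qed
  \<comment> \<open>\<open>P\<close> serves as its own asymptote, since it is eventually
    nonzero.\<close>
  have "((\<lambda>\<rho>. P \<rho> / P \<rho>) \<longlongrightarrow> 1) at_top"
    by (rule tendsto_eventually) (use P_pos in \<open>eventually_elim, simp\<close>)
  then have "high_snr_asymptote P P"
    by (simp add: high_snr_asymptote_def)
  moreover have "((\<lambda>\<rho>. ln (Q \<rho>) / ln \<rho>) \<longlongrightarrow> - d) at_top" if "high_snr_asymptote P Q" for Q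
  proof -
    have ratio: "((\<lambda>\<rho>. P \<rho> / Q \<rho>) \<longlongrightarrow> 1) at_top"
      using that by (simp add: high_snr_asymptote_def)
    then have "((\<lambda>\<rho>. ln (P \<rho> / Q \<rho>)) \<longlongrightarrow> ln 1) at_top"
      by (rule tendsto_ln) simp
    then have "((\<lambda>\<rho>. ln (P \<rho> / Q \<rho>) / ln \<rho>) \<longlongrightarrow> 0) at_top"
      by (rule real_tendsto_divide_at_top) (rule ln_at_top)
    from tendsto_diff[OF P_lim this]
    have lim: "((\<lambda>\<rho>. ln (P \<rho>) / ln \<rho> - ln (P \<rho> / Q \<rho>) / ln \<rho>) \<longlongrightarrow> - d) at_top"
      by simp
    \<comment> \<open>A ratio near 1 is positive, which together with \<open>P_pos\<close> makes
      \<open>Q\<close> eventually positive; only then does the logarithm of the quotient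
      split.\<close>
    have "eventually (\<lambda>\<rho>. 0 < P \<rho> / Q \<rho>) at_top"
      using ratio by (rule order_tendstoD) simp
    then have "eventually (\<lambda>\<rho>. ln (P \<rho>) / ln \<rho> - ln (P \<rho> / Q \<rho>) / ln \<rho> = ln (Q \<rho>) / ln \<rho>) at_top"
      using P_pos
    proof eventually_elim
      case (elim \<rho>)
      then have "0 < Q \<rho>"
        by (simp add: zero_less_divide_iff)
      with elim show ?case
        by (simp add: ln_div diff_divide_distrib)
    qed
    with lim show ?thesis
      by (rule Lim_transform_eventually)
  qed
  ultimately show ?thesis
    unfolding has_diversity_order_def by blast
qed

section \<open>SINR conditions as thresholds on the gain\<close>

text \<open>Clearing the positive denominator leaves \<open>z\<close> times
  \<open>(a\<^sub>m - \<epsilon> * a\<^sub>n) * \<rho>\<close> on the left. The assumption on the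
  power coefficients makes this factor positive, so the condition is an upper threshold on
  \<open>z\<close> of order \<open>1 / \<rho>\<close>.\<close>

lemma sinr_cross_le_iff:
  assumes "0 < \<rho>" and "0 \<le> z" and "0 < a\<^sub>n" and "a\<^sub>m > \<epsilon> * a\<^sub>n"
  shows "sinr_cross a\<^sub>m a\<^sub>n \<rho> z \<le> \<epsilon> \<longleftrightarrow> z \<le> \<epsilon> / (a\<^sub>m - \<epsilon> * a\<^sub>n) / \<rho>"
proof -
  have "0 < \<rho> * z * a\<^sub>n + 1"
    using assms by (simp add: add_nonneg_pos)
  then have "sinr_cross a\<^sub>m a\<^sub>n \<rho> z \<le> \<epsilon> \<longleftrightarrow> z * ((a\<^sub>m - \<epsilon> * a\<^sub>n) * \<rho>) \<le> \<epsilon>"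
    unfolding sinr_cross_def by (simp add: pos_divide_le_eq algebra_simps)
  also have "\<dots> \<longleftrightarrow> z \<le> \<epsilon> / ((a\<^sub>m - \<epsilon> * a\<^sub>n) * \<rho>)"
    using assms by (subst pos_le_divide_eq) auto
  finally show ?thesis
    by simp
qed

lemma sinr_own_perfect_SIC_le_iff:
  assumes "0 < \<rho>" and "0 < a\<^sub>n"
  shows "sinr_own 0 a\<^sub>n \<rho> z y \<le> \<epsilon> \<longleftrightarrow> z \<le> \<epsilon> / a\<^sub>n / \<rho>"
  using assms by (simp add: sinr_own_def pos_le_divide_eq mult_ac)

text \<open>The noise term 1 in the denominator only lowers the SINR. Ignoring it lets
  \<open>\<rho>\<close> cancel and leaves a sufficient condition free of the SNR.\<close>

lemma sinr_own_imperfect_SIC_le: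
  assumes "0 < \<rho>" and "0 \<le> y" and "0 < \<epsilon>" and "z * a\<^sub>n \<le> \<epsilon> * y"
  shows "sinr_own 1 a\<^sub>n \<rho> z y \<le> \<epsilon>"
proof -
  have "\<rho> * (z * a\<^sub>n) \<le> \<rho> * (\<epsilon> * y)"
    using assms by (intro mult_left_mono) auto
  moreover have "0 < \<rho> * y + 1"
    using assms by (simp add: add_nonneg_pos)
  ultimately show ?thesis
    using assms(3) by (simp add: sinr_own_def pos_divide_le_eq algebra_simps)
qed

section \<open>The two diversity orders\<close>

theorem mainTheorem5:
  fixes \<Omega> :: "'w measure" and M K m n :: nat
    and \<eta> \<alpha> R\<^sub>D \<Omega>\<^sub>I a\<^sub>m a\<^sub>n R\<^sub>m R\<^sub>n \<epsilon>\<^sub>m \<epsilon>\<^sub>n :: real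
    and loc :: "nat \<Rightarrow> 'w \<Rightarrow> complex" and h :: "nat \<Rightarrow> nat \<Rightarrow> 'w \<Rightarrow> complex"
    and h\<^sub>I :: "nat \<Rightarrow> 'w \<Rightarrow> complex" and Z\<^sub>n Y\<^sub>I :: "'w \<Rightarrow> real"
  assumes "1 \<le> K" and "K < M" and "K \<noteq> 1"
    and "1 \<le> m" and "m < n" and "n \<le> M"
    and "\<eta> > 0" and "\<alpha> > 0" and "R\<^sub>D > 0" and "\<Omega>\<^sub>I > 0"
    and "a\<^sub>m > a\<^sub>n" and "a\<^sub>n > 0" and "a\<^sub>m + a\<^sub>n = 1"
    and "R\<^sub>m > 0" and "R\<^sub>n > 0"
    and "\<epsilon>\<^sub>m = 2 powr R\<^sub>m - 1" and "\<epsilon>\<^sub>n = 2 powr R\<^sub>n - 1"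
    and "noma_randomness \<Omega> M K R\<^sub>D \<Omega>\<^sub>I loc h h\<^sub>I"
    and "Z\<^sub>n = (\<lambda>\<omega>. sq_norm K (ordered_channel M K \<eta> \<alpha> loc h n \<omega>))"
    and "Y\<^sub>I = (\<lambda>\<omega>. sq_norm K (\<lambda>k. h\<^sub>I k \<omega>))"
    and "a\<^sub>m > \<epsilon>\<^sub>m * a\<^sub>n"
  shows "has_diversity_order (outage_EXF \<Omega> Z\<^sub>n Y\<^sub>I a\<^sub>m a\<^sub>n \<epsilon>\<^sub>m \<epsilon>\<^sub>n 1) 0 \<and>
         has_diversity_order (outage_EXF \<Omega> Z\<^sub>n Y\<^sub>I a\<^sub>m a\<^sub>n \<epsilon>\<^sub>m \<epsilon>\<^sub>n 0) (real (n * K))"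
proof -
  interpret noma_randomness \<Omega> M K R\<^sub>D \<Omega>\<^sub>I loc h h\<^sub>I by fact
  have n: "1 \<le> n"
    using \<open>1 \<le> m\<close> \<open>m < n\<close> by simp
  have \<epsilon>: "0 < \<epsilon>\<^sub>m" "0 < \<epsilon>\<^sub>n"
    using assms by auto
  note gain_facts = \<open>1 \<le> K\<close> \<open>\<eta> > 0\<close> n \<open>n \<le> M\<close>
  note Z_def = \<open>Z\<^sub>n = _\<close>
  note Y_def = \<open>Y\<^sub>I = _\<close>
  have Z_meas[measurable]: "Z\<^sub>n \<in> borel_measurable \<Omega>"
    using ordered_gain_measurable[OF gain_facts] by (simp add: Z_def)
  have Z_nonneg: "0 \<le> Z\<^sub>n \<omega>" for \<omega>
    by (simp add: Z_def sq_norm_nonneg)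
  have Y_nonneg: "0 \<le> Y\<^sub>I \<omega>" for \<omega>
    by (simp add: Y_def sq_norm_nonneg)
  have [measurable]: "\<And>k. k \<in> {1..K} \<Longrightarrow> h\<^sub>I k \<in> borel_measurable \<Omega>"
    by (rule interference_measurable)
  have Y_meas[measurable]: "Y\<^sub>I \<in> borel_measurable \<Omega>"
    unfolding Y_def sq_norm_eq_sum by measurable
  have "has_diversity_order (outage_EXF \<Omega> Z\<^sub>n Y\<^sub>I a\<^sub>m a\<^sub>n \<epsilon>\<^sub>m \<epsilon>\<^sub>n 1) 0"
  \<comment> \<open>For \<open>d = 0\<close> the power of \<open>\<rho>\<close> is 1, so constants
    suffice: the probability of a fixed event \<open>E\<close> from below, and 2 from above as a sum
    of two probabilities.\<close>
  proof (rule has_diversity_orderI)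
    \<comment> \<open>\<open>x\<close> solves
      \<open>x * a\<^sub>n = \<epsilon>\<^sub>n * (\<Omega>\<^sub>I / 2)\<close>, and
      \<open>r\<close> is the fading level that forces \<open>Z\<^sub>n \<le> x\<close>. On
      \<open>E\<close> the interference exceeds \<open>\<Omega>\<^sub>I / 2\<close>, which yields
      \<open>E_bound\<close>.\<close>
    define x where "x = \<epsilon>\<^sub>n * (\<Omega>\<^sub>I / 2) / a\<^sub>n"
    define r where "r = x / (\<eta> * real K)"
    define E where "E = {\<omega> \<in> space \<Omega>. (\<forall>i\<in>{1..n}. \<forall>k\<in>{1..K}. (cmod (h i k \<omega>))\<^sup>2 \<le> r) \<and>
      (cmod (h\<^sub>I 1 \<omega>))\<^sup>2 > \<Omega>\<^sub>I / 2}"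
    have "0 < r"
      using assms(1,7,10,12) \<epsilon> by (simp add: r_def x_def)
    then show "0 < prob E"
      unfolding E_def using assms(1,6,10)
      by (intro prob_fading_le_interference_gt_pos) auto
    have E_bound: "Z\<^sub>n \<omega> * a\<^sub>n \<le> \<epsilon>\<^sub>n * Y\<^sub>I \<omega>" if "\<omega> \<in> E" for \<omega>
    proof -
      have "Z\<^sub>n \<omega> \<le> x"
        unfolding Z_def using that
        by (intro ordered_gain_le_of_fading_le[OF gain_facts]) (simp add: E_def r_def)
      then have "Z\<^sub>n \<omega> * a\<^sub>n \<le> \<epsilon>\<^sub>n * (\<Omega>\<^sub>I / 2)"
        using assms(12) by (simp add: x_def pos_le_divide_eq)
      also have "\<dots> \<le> \<epsilon>\<^sub>n * Y\<^sub>I \<omega>"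
      proof (rule mult_left_mono)
        have "\<Omega>\<^sub>I / 2 \<le> (cmod (h\<^sub>I 1 \<omega>))\<^sup>2"
          using that by (simp add: E_def)
        also have "\<dots> \<le> Y\<^sub>I \<omega>"
          unfolding Y_def sq_norm_eq_sum using assms(1)
          by (intro member_le_sum[where f = "\<lambda>k. (cmod (h\<^sub>I k \<omega>))\<^sup>2"]) auto
        finally show "\<Omega>\<^sub>I / 2 \<le> Y\<^sub>I \<omega>" .
      qed (use \<epsilon> in simp)
      finally show ?thesis .
    qed
    show "eventually (\<lambda>\<rho>. prob E * \<rho> powr - 0 \<le> outage_EXF \<Omega> Z\<^sub>n Y\<^sub>I a\<^sub>m a\<^sub>n \<epsilon>\<^sub>m \<epsilon>\<^sub>n 1 \<rho>) at_top"
      using eventually_gt_at_top[of 0]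
    proof eventually_elim
      case (elim \<rho>)
      let ?A = "{\<omega> \<in> space \<Omega>. sinr_cross a\<^sub>m a\<^sub>n \<rho> (Z\<^sub>n \<omega>) \<le> \<epsilon>\<^sub>m}"
      let ?B = "{\<omega> \<in> space \<Omega>. sinr_cross a\<^sub>m a\<^sub>n \<rho> (Z\<^sub>n \<omega>) > \<epsilon>\<^sub>m \<and>
        sinr_own 1 a\<^sub>n \<rho> (Z\<^sub>n \<omega>) (Y\<^sub>I \<omega>) \<le> \<epsilon>\<^sub>n}"
      have events: "?A \<in> events" "?B \<in> events"
        unfolding sinr_cross_def sinr_own_def by measurable
      \<comment> \<open>On \<open>E\<close> the own SINR is in outage for every positive
        \<open>\<rho>\<close>. Whether the cross SINR fails as well only decides between
        \<open>?A\<close> and \<open>?B\<close>.\<close>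
      have "E \<subseteq> ?A \<union> ?B"
        using E_bound sinr_own_imperfect_SIC_le[OF elim Y_nonneg \<epsilon>(2)]
        by (auto simp: E_def not_le)
      then have "prob E \<le> prob (?A \<union> ?B)"
        using events by (intro finite_measure_mono) auto
      also have "\<dots> \<le> prob ?A + prob ?B"
        using events by (intro measure_subadditive) (auto simp: emeasure_eq_measure)
      finally show ?case
        using elim by (simp add: outage_EXF_def)
    qed
    show "eventually (\<lambda>\<rho>. outage_EXF \<Omega> Z\<^sub>n Y\<^sub>I a\<^sub>m a\<^sub>n \<epsilon>\<^sub>m \<epsilon>\<^sub>n 1 \<rho> \<le> 2 * \<rho> powr - 0) at_top"
      using eventually_gt_at_top[of 0]
    proof eventually_elim
      case (elim \<rho>)
      show ?case
        unfolding outage_EXF_def using elim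
        by (simp add: add_mono[OF prob_le_1 prob_le_1, simplified])
    qed
  qed
  moreover have "has_diversity_order (outage_EXF \<Omega> Z\<^sub>n Y\<^sub>I a\<^sub>m a\<^sub>n \<epsilon>\<^sub>m \<epsilon>\<^sub>n 0) (real (n * K))"
  proof -
    define F where "F = (\<lambda>x. prob {\<omega> \<in> space \<Omega>. Z\<^sub>n \<omega> \<le> x})"
    have F_mono: "F x \<le> F y" if "x \<le> y" for x y
      unfolding F_def using that by (intro finite_measure_mono) auto
    \<comment> \<open>\<open>t / \<rho>\<close> is the gain threshold of the cross SINR and
      \<open>\<epsilon>\<^sub>n / a\<^sub>n / \<rho>\<close> that of the own SINR;
      \<open>s / \<rho>\<close> dominates both.\<close>
    define t where "t = \<epsilon>\<^sub>m / (a\<^sub>m - \<epsilon>\<^sub>m * a\<^sub>n)"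
    define s where "s = max t (\<epsilon>\<^sub>n / a\<^sub>n)"
    have "0 < t"
      using assms(21) \<epsilon> by (simp add: t_def)
    then have "0 < s"
      by (simp add: s_def)
    define c where "c = (exp (- 1) / (\<eta> * real K)) ^ (n * K)"
    have "0 < c"
      using assms(1,7) by (simp add: c_def)
    have F_lower: "c * x ^ (n * K) \<le> F x" if "0 \<le> x" "x \<le> \<eta> * real K" for x
      using prob_ordered_gain_le_lower[OF gain_facts that]
      by (simp add: F_def c_def Z_def)
    obtain C where F_upper: "F x \<le> C * x ^ (n * K)" if "0 \<le> x" for x
      using prob_ordered_gain_le_upper[OF gain_facts assms(8)]
      unfolding F_def Z_def by blast
    have power_eq: "(y / \<rho>) ^ (n * K) = y ^ (n * K) * \<rho> powr - real (n * K)"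
      if "0 < \<rho>" for y \<rho> :: real
      using that by (simp add: power_divide powr_minus powr_realpow divide_inverse power_mult_distrib power_inverse
          del: of_nat_mult)
    show ?thesis
    proof (rule has_diversity_orderI)
      show "0 < c * t ^ (n * K)"
        using \<open>0 < c\<close> \<open>0 < t\<close> by simp
      \<comment> \<open>High SNR brings \<open>t / \<rho>\<close> into the range where
        \<open>F_lower\<close> applies.\<close>
      have "((\<lambda>\<rho>. t / \<rho>) \<longlongrightarrow> 0) at_top"
        by real_asymp
      then have "eventually (\<lambda>\<rho>. t / \<rho> < \<eta> * real K) at_top"
        using assms(1,7) by (intro order_tendstoD) auto
      then show "eventually (\<lambda>\<rho>. c * t ^ (n * K) * \<rho> powr - real (n * K) \<le>
          outage_EXF \<Omega> Z\<^sub>n Y\<^sub>I a\<^sub>m a\<^sub>n \<epsilon>\<^sub>m \<epsilon>\<^sub>n 0 \<rho>) at_top"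
        using eventually_gt_at_top[of 0]
      proof eventually_elim
        case (elim \<rho>)
        have "c * t ^ (n * K) * \<rho> powr - real (n * K) = c * (t / \<rho>) ^ (n * K)"
          using elim by (simp only: power_eq mult.assoc)
        also have "\<dots> \<le> F (t / \<rho>)"
          using elim \<open>0 < t\<close> by (intro F_lower) auto
        also have "F (t / \<rho>) = prob {\<omega> \<in> space \<Omega>. sinr_cross a\<^sub>m a\<^sub>n \<rho> (Z\<^sub>n \<omega>) \<le> \<epsilon>\<^sub>m}"
          using elim assms(12,21) by (simp add: F_def t_def sinr_cross_le_iff Z_nonneg)
        \<comment> \<open>The first outage term alone has the right order; the second is nonnegative
          and dropped.\<close>
        also have "\<dots> \<le> outage_EXF \<Omega> Z\<^sub>n Y\<^sub>I a\<^sub>m a\<^sub>n \<epsilon>\<^sub>m \<epsilon>\<^sub>n 0 \<rho>"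
          by (simp add: outage_EXF_def)
        finally show ?case .
      qed
      show "eventually (\<lambda>\<rho>. outage_EXF \<Omega> Z\<^sub>n Y\<^sub>I a\<^sub>m a\<^sub>n \<epsilon>\<^sub>m \<epsilon>\<^sub>n 0 \<rho> \<le>
          (2 * C * s ^ (n * K)) * \<rho> powr - real (n * K)) at_top"
        using eventually_gt_at_top[of 0]
      proof eventually_elim
        case (elim \<rho>)
        have "prob {\<omega> \<in> space \<Omega>. sinr_cross a\<^sub>m a\<^sub>n \<rho> (Z\<^sub>n \<omega>) \<le> \<epsilon>\<^sub>m} = F (t / \<rho>)"
          using elim assms(12,21) by (simp add: F_def t_def sinr_cross_le_iff Z_nonneg)
        moreover have "F (t / \<rho>) \<le> F (s / \<rho>)"
          using elim by (intro F_mono divide_right_mono) (auto simp: s_def)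
        \<comment> \<open>Forgetting the condition on the cross SINR leaves the pure threshold event
          of the own SINR. Both outage terms are then at most \<open>F (s / \<rho>)\<close>, whence
          the factor 2.\<close>
        moreover have "prob {\<omega> \<in> space \<Omega>. sinr_cross a\<^sub>m a\<^sub>n \<rho> (Z\<^sub>n \<omega>) > \<epsilon>\<^sub>m \<and>
            sinr_own 0 a\<^sub>n \<rho> (Z\<^sub>n \<omega>) (Y\<^sub>I \<omega>) \<le> \<epsilon>\<^sub>n} \<le> F (\<epsilon>\<^sub>n / a\<^sub>n / \<rho>)"
          unfolding F_def using elim assms(12)
          by (intro finite_measure_mono) (auto simp: sinr_own_perfect_SIC_le_iff)
        moreover have "F (\<epsilon>\<^sub>n / a\<^sub>n / \<rho>) \<le> F (s / \<rho>)"
          using elim by (intro F_mono divide_right_mono) (auto simp: s_def)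
        ultimately have "outage_EXF \<Omega> Z\<^sub>n Y\<^sub>I a\<^sub>m a\<^sub>n \<epsilon>\<^sub>m \<epsilon>\<^sub>n 0 \<rho> \<le> 2 * F (s / \<rho>)"
          by (simp add: outage_EXF_def)
        also have "\<dots> \<le> 2 * (C * (s / \<rho>) ^ (n * K))"
          using elim \<open>0 < s\<close> by (intro mult_left_mono F_upper) auto
        also have "\<dots> = (2 * C * s ^ (n * K)) * \<rho> powr - real (n * K)"
          using elim by (simp only: power_eq mult.assoc)
        finally show ?case .
      qed
    qed
  qed
  ultimately show ?thesis ..
qed

end
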